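(* Let $(\mathcal{S},\mathcal{A},P)$ be the state space, action space and transition probabilities of an MDP, and let $s_t,a_t\to s_{t+1}$ be an observed transition, so $P(s_{t+1}\mid s_t,a_t)>0$. Let $\tilde P_t^{LB}(\tilde s'\mid \tilde s,\tilde a)$ and $\tilde P_t^{UB}(\tilde s'\mid \tilde s,\tilde a)$ be the minimum and maximum of $\tilde P_t^{\theta}(\tilde s'\mid \tilde s,\tilde a)$ over all feasible $\theta$ (feasibility, including counterfactual stability and monotonicity, as defined in the context). Let $(\tilde s,\tilde a)\ne(s_t,a_t)$ be a state-action pair whose support overlaps (has nonempty intersection with) the support of $(s_t,a_t)$. Say that $\tilde s'$ satisfies the CS conditions if $P(\tilde s'\mid s_t,a_t)>0$ and $\dfrac{P(s_{t+1}\mid\tilde s,\tilde a)}{P(s_{t+1}\mid s_t,a_t)}\ge\dfrac{P(\tilde s'\mid\tilde s,\tilde a)}{P(\tilde s'\mid s_t,a_t)}$. Then for every $\tilde s'\in\mathcal{S}$, where in each display the first applicable case is used: $$\tilde P_t^{UB}(\tilde s'\mid\tilde s,\tilde a)=\begin{cases}\dfrac{\min\bigl(P(s_{t+1}\mid s_t,a_t),\,P(s_{t+1}\mid\tilde s,\tilde a)\bigr)}{P(s_{t+1}\mid s_t,a_t)} & \text{if }\tilde s'=s_{t+1},\\[2mm] 0&\text{if }\tilde s'\text{ satisfies the CS conditions},\\[1mm] \min\bigl(P(\tilde s'\mid\tilde s,\tilde a),\,1-P(s_{t+1}\mid\tilde s,\tilde a)\bigr)&\text{if }P(\tilde s'\mid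 s_t,a_t)>0,\\[1mm] \min\left(1-P(s_{t+1}\mid\tilde s,\tilde a),\,\dfrac{P(\tilde s'\mid\tilde s,\tilde a)}{P(s_{t+1}\mid s_t,a_t)}\right)&\text{otherwise,}\end{cases}$$ $$\tilde P_t^{LB}(\tilde s'\mid\tilde s,\tilde a)=\begin{cases}\max\left(P(\tilde s'\mid\tilde s,\tilde a),\,1-\sum_{s'\in\mathcal{S}\setminus\{\tilde s'\}}\tilde P_t^{UB}(s'\mid\tilde s,\tilde a)\right)&\text{if }\tilde s'=s_{t+1},\\[1mm] 0&\text{if }\tilde s'\text{ satisfies the CS conditions},\\[1mm] \max\left(0,\,1-\sum_{s'\in\mathcal{S}\setminus\{\tilde s'\}}\tilde P_t^{UB}(s'\mid\tilde s,\tilde a)\right)&\text{otherwise.}\end{cases}$$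
   Context: $\mathcal{S}$ (states) and $\mathcal{A}$ (actions) are finite nonempty sets and $P(\cdot\mid s,a)$ is a probability distribution on $\mathcal{S}$ for every $(s,a)\in\mathcal{S}\times\mathcal{A}$. The support of $(s,a)$ is $\{s'\in\mathcal{S}: P(s'\mid s,a)>0\}$. Canonical SCM: let $U_t$ be the finite set indexing all functions $\mathcal{S}\times\mathcal{A}\to\mathcal{S}$, so $|U_t|=|\mathcal{S}|^{|\mathcal{S}||\mathcal{A}|}$; write $f(s,a,u)\in\mathcal{S}$ for the value at $(s,a)$ of the function indexed by $u\in U_t$, and $\mu_{s,a,u,s'}=1$ if $f(s,a,u)=s'$ and $0$ otherwise. A vector $\theta\in\mathbb{R}^{U_t}$ represents a distribution on $U_t$. Given the observed transition $s_t,a_t\to s_{t+1}$ with $P(s_{t+1}\mid s_t,a_t)>0$, the counterfactual probability induced by $\theta$ is $$\tilde P_t^{\theta}(\tilde s'\mid\tilde s,\tilde a)=\frac{\sum_{u\in U_t}\mu_{\tilde s,\tilde a,u,\tilde s'}\,\mu_{s_t,a_t,u,s_{t+1}}\,\theta_u}{P(s_{t+1}\mid s_t,a_t)}.$$ $\theta$ is feasible if all of the following hold: (Prob) $0\le\theta_u\le1$ for all $u$ and $\sum_u\theta_u=1$; (Int) $\sum_u\mu_{s,a,u,s'}\theta_u=P(s'\mid s,a)$ for all $s,a,s'$; (CS, counterfactual stability) for all $(\tilde s,\tilde a)\ne(s_t,a_t)$ and all $\tilde s'\ne s_{t+1}$ with $P(\tilde s'\mid s_t,a_t)>0$ and $\frac{P(s_{t+1}\mid\tilde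 s,\tilde a)}{P(s_{t+1}\mid s_t,a_t)}\ge\frac{P(\tilde s'\mid\tilde s,\tilde a)}{P(\tilde s'\mid s_t,a_t)}$, one has $\tilde P^\theta_t(\tilde s'\mid\tilde s,\tilde a)=0$; (Mon1) for all $\tilde s,\tilde a$ with $P(s_{t+1}\mid\tilde s,\tilde a)>0$: $\tilde P^\theta_t(s_{t+1}\mid\tilde s,\tilde a)\ge P(s_{t+1}\mid\tilde s,\tilde a)$; (Mon2) for all $\tilde s,\tilde a$ and all $\tilde s'\ne s_{t+1}$ with $P(\tilde s'\mid s_t,a_t)>0$: $\tilde P^\theta_t(\tilde s'\mid\tilde s,\tilde a)\le P(\tilde s'\mid\tilde s,\tilde a)$. The assertion that the minimum/maximum equals a value includes that it is attained (in particular that a feasible $\theta$ exists). *)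

theory Defs
  imports "HOL-Probability.Probability_Mass_Function"
begin

text \<open>
  The transition kernel of an MDP with state type \<open>'s\<close> and action type \<open>'a\<close> (both of class
  \<open>finite\<close>) is \<open>P :: 's \<Rightarrow> 'a \<Rightarrow> 's pmf\<close>, so that \<open>pmf (P s a) s'\<close> is the probability
  \<open>P(s' | s, a)\<close> and \<open>set_pmf (P s a)\<close> is the support of \<open>(s, a)\<close>.
  The observed transition is \<open>sT, aT \<rightarrow> sN\<close>.

  The exogenous values of the canonical SCM index all functions from state-action pairs to
  states; they are taken to be these functions themselves, so that \<open>f(s, a, u)\<close> is \<open>u (s, a)\<close>.
\<close>

type_synonym ('s, 'a) exo = "'s \<times> 'a \<Rightarrow> 's"

definition scm_mu :: "'s \<Rightarrow> 'a \<Rightarrow> ('s, 'a) exo \<Rightarrow> 's \<Rightarrow> real" where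
  "scm_mu s a u s' = (if u (s, a) = s' then 1 else 0)"

definition cf_prob ::
  "('s::finite \<Rightarrow> 'a::finite \<Rightarrow> 's pmf) \<Rightarrow> 's \<Rightarrow> 'a \<Rightarrow> 's
     \<Rightarrow> (('s, 'a) exo \<Rightarrow> real) \<Rightarrow> 's \<Rightarrow> 'a \<Rightarrow> 's \<Rightarrow> real" where
  "cf_prob P sT aT sN \<theta> s a s' =
     (\<Sum>u\<in>UNIV. scm_mu s a u s' * scm_mu sT aT u sN * \<theta> u) / pmf (P sT aT) sN"

definition cs_conditions ::
  "('s \<Rightarrow> 'a \<Rightarrow> 's pmf) \<Rightarrow> 's \<Rightarrow> 'a \<Rightarrow> 's \<Rightarrow> 's \<Rightarrow> 'a \<Rightarrow> 's \<Rightarrow> bool" where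
  "cs_conditions P sT aT sN s a s' \<longleftrightarrow>
     pmf (P sT aT) s' > 0 \<and>
     pmf (P s a) sN / pmf (P sT aT) sN \<ge> pmf (P s a) s' / pmf (P sT aT) s'"

definition prob_constraint :: "(('s::finite, 'a::finite) exo \<Rightarrow> real) \<Rightarrow> bool" where
  "prob_constraint \<theta> \<longleftrightarrow> (\<forall>u. 0 \<le> \<theta> u \<and> \<theta> u \<le> 1) \<and> (\<Sum>u\<in>UNIV. \<theta> u) = 1"

definition int_constraint ::
  "('s::finite \<Rightarrow> 'a::finite \<Rightarrow> 's pmf) \<Rightarrow> (('s, 'a) exo \<Rightarrow> real) \<Rightarrow> bool" where
  "int_constraint P \<theta> \<longleftrightarrow>
     (\<forall>s a s'. (\<Sum>u\<in>UNIV. scm_mu s a u s' * \<theta> u) = pmf (P s a) s')"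

definition cs_constraint ::
  "('s::finite \<Rightarrow> 'a::finite \<Rightarrow> 's pmf) \<Rightarrow> 's \<Rightarrow> 'a \<Rightarrow> 's
     \<Rightarrow> (('s, 'a) exo \<Rightarrow> real) \<Rightarrow> bool" where
  "cs_constraint P sT aT sN \<theta> \<longleftrightarrow>
     (\<forall>s a s'. (s, a) \<noteq> (sT, aT) \<longrightarrow> s' \<noteq> sN \<longrightarrow> cs_conditions P sT aT sN s a s' \<longrightarrow>
        cf_prob P sT aT sN \<theta> s a s' = 0)"

definition mon1_constraint ::
  "('s::finite \<Rightarrow> 'a::finite \<Rightarrow> 's pmf) \<Rightarrow> 's \<Rightarrow> 'a \<Rightarrow> 's
     \<Rightarrow> (('s, 'a) exo \<Rightarrow> real) \<Rightarrow> bool" where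
  "mon1_constraint P sT aT sN \<theta> \<longleftrightarrow>
     (\<forall>s a. pmf (P s a) sN > 0 \<longrightarrow> cf_prob P sT aT sN \<theta> s a sN \<ge> pmf (P s a) sN)"

definition mon2_constraint ::
  "('s::finite \<Rightarrow> 'a::finite \<Rightarrow> 's pmf) \<Rightarrow> 's \<Rightarrow> 'a \<Rightarrow> 's
     \<Rightarrow> (('s, 'a) exo \<Rightarrow> real) \<Rightarrow> bool" where
  "mon2_constraint P sT aT sN \<theta> \<longleftrightarrow>
     (\<forall>s a s'. s' \<noteq> sN \<longrightarrow> pmf (P sT aT) s' > 0 \<longrightarrow>
        cf_prob P sT aT sN \<theta> s a s' \<le> pmf (P s a) s')"

definition feasible ::
  "('s::finite \<Rightarrow> 'a::finite \<Rightarrow> 's pmf) \<Rightarrow> 's \<Rightarrow> 'a \<Rightarrow> 's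
     \<Rightarrow> (('s, 'a) exo \<Rightarrow> real) \<Rightarrow> bool" where
  "feasible P sT aT sN \<theta> \<longleftrightarrow>
     prob_constraint \<theta> \<and> int_constraint P \<theta> \<and> cs_constraint P sT aT sN \<theta> \<and>
     mon1_constraint P sT aT sN \<theta> \<and> mon2_constraint P sT aT sN \<theta>"

definition cf_values ::
  "('s::finite \<Rightarrow> 'a::finite \<Rightarrow> 's pmf) \<Rightarrow> 's \<Rightarrow> 'a \<Rightarrow> 's \<Rightarrow> 's \<Rightarrow> 'a \<Rightarrow> 's \<Rightarrow> real set" where
  "cf_values P sT aT sN s a s' = {cf_prob P sT aT sN \<theta> s a s' | \<theta>. feasible P sT aT sN \<theta>}"

definition is_maximum :: "real set \<Rightarrow> real \<Rightarrow> bool" where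
  "is_maximum A m \<longleftrightarrow> m \<in> A \<and> (\<forall>x\<in>A. x \<le> m)"

definition is_minimum :: "real set \<Rightarrow> real \<Rightarrow> bool" where
  "is_minimum A m \<longleftrightarrow> m \<in> A \<and> (\<forall>x\<in>A. m \<le> x)"

text \<open>
  The bounds are given by definite description and so are meaningful only when the extremum is
  attained; statements about them should assert \<open>is_maximum\<close> or \<open>is_minimum\<close> separately.
\<close>

definition cf_UB ::
  "('s::finite \<Rightarrow> 'a::finite \<Rightarrow> 's pmf) \<Rightarrow> 's \<Rightarrow> 'a \<Rightarrow> 's \<Rightarrow> 's \<Rightarrow> 'a \<Rightarrow> 's \<Rightarrow> real" where
  "cf_UB P sT aT sN s a s' = (THE m. is_maximum (cf_values P sT aT sN s a s') m)"

definition cf_LB ::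
  "('s::finite \<Rightarrow> 'a::finite \<Rightarrow> 's pmf) \<Rightarrow> 's \<Rightarrow> 'a \<Rightarrow> 's \<Rightarrow> 's \<Rightarrow> 'a \<Rightarrow> 's \<Rightarrow> real" where
  "cf_LB P sT aT sN s a s' = (THE m. is_minimum (cf_values P sT aT sN s a s') m)"

end

theory Submission
  imports Defs
begin

text \<open>
  For \<open>(s, a) \<noteq> (sT, aT)\<close> the counterfactual distributions \<open>c\<close> induced by feasible \<open>\<theta>\<close> are exactly
  the probability vectors lying in an explicit box. Given one such vector for every state-action
  pair, and the point mass at \<open>sN\<close> for \<open>(sT, aT)\<close>, write \<open>Z = P(sN | sT, aT)\<close> and
  \<open>P(\<cdot> | k) = Z c\<^sub>k + (1 - Z) d\<^sub>k\<close>; the mixture, with weights \<open>Z\<close> and \<open>1 - Z\<close>, of the product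
  measures of the \<open>c\<^sub>k\<close> and of the \<open>d\<^sub>k\<close> is then a feasible \<open>\<theta>\<close> inducing them. The box meets the
  simplex for every pair, because the states excluded by counterfactual stability have total
  probability at most \<open>(1 - Z) P(sN | s, a) / Z\<close>. The bounds are the extrema of a coordinate over
  the intersection of a box with the simplex.
\<close>

section \<open>Marginals of product measures on functions\<close>

lemma sum_prod_marginal:
  fixes g :: "'k::finite \<Rightarrow> 'x::finite \<Rightarrow> real"
  assumes "\<And>j. (\<Sum>y\<in>UNIV. g j y) = 1"
  shows "(\<Sum>u\<in>UNIV. (if u k = x then 1 else 0) * (\<Prod>j\<in>UNIV. g j (u j))) = g k x"
proof -
  \<comment> \<open>\<open>h\<close> absorbs the indicator into the factor at \<open>k\<close>, so
    that the sum over all functions factors into one sum per index; all but the one at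
    \<open>k\<close> equal 1.\<close>
  define h where "h j y = (if j = k \<and> y \<noteq> x then 0 else g j y)" for j y
  have "(if u k = x then 1 else 0) * (\<Prod>j\<in>UNIV. g j (u j)) = (\<Prod>j\<in>UNIV. h j (u j))" for u
    by (cases "u k = x") (auto simp: h_def intro!: prod.cong prod_zero[symmetric])
  then have "(\<Sum>u\<in>UNIV. (if u k = x then 1 else 0) * (\<Prod>j\<in>UNIV. g j (u j)))
      = (\<Sum>u\<in>PiE UNIV (\<lambda>_. UNIV). \<Prod>j\<in>UNIV. h j (u j))"
    by simp
  also have "\<dots> = (\<Prod>j\<in>UNIV. \<Sum>y\<in>UNIV. h j y)"
    by (rule prod_sum_PiE[symmetric]) auto
  also have "\<dots> = (\<Prod>j\<in>UNIV. if j = k then g k x else 1)"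
  proof (rule prod.cong)
    fix j
    have "(\<Sum>y\<in>UNIV. h k y) = (\<Sum>y\<in>UNIV. if y = x then g k x else 0)"
      by (rule sum.cong) (auto simp: h_def)
    then show "(\<Sum>y\<in>UNIV. h j y) = (if j = k then g k x else 1)"
      using assms by (auto simp: h_def)
  qed simp
  finally show ?thesis by simp
qed

lemma sum_prod_total:
  fixes g :: "'k::finite \<Rightarrow> 'x::finite \<Rightarrow> real"
  assumes "\<And>j. (\<Sum>y\<in>UNIV. g j y) = 1"
  shows "(\<Sum>u\<in>UNIV. \<Prod>j\<in>UNIV. g j (u j)) = 1"
  using prod_sum_PiE[of UNIV "\<lambda>_. UNIV" g] assms by simp

section \<open>Intersections of a box with the simplex\<close>

lemma box_meets_simplex:
  fixes lo hi :: "'x::finite \<Rightarrow> real"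
  assumes le: "\<And>x. lo x \<le> hi x" and lo: "sum lo UNIV \<le> 1" and hi: "1 \<le> sum hi UNIV"
  obtains c where "\<And>x. lo x \<le> c x" "\<And>x. c x \<le> hi x" "sum c UNIV = 1"
\<comment> \<open>This case is split off because \<open>D\<close> may vanish in it.\<close>
proof (cases "sum lo UNIV = 1")
  case True
  with le that[of lo] show ?thesis by auto
next
  case False
  define D where "D = sum hi UNIV - sum lo UNIV"
  \<comment> \<open>The total is affine along the segment from \<open>lo\<close> to
    \<open>hi\<close>, and \<open>t\<close> is the parameter at which it equals 1.\<close>
  define t where "t = (1 - sum lo UNIV) / D"
  have "D > 0" using False lo hi by (simp add: D_def)
  then have t: "0 \<le> t" "t \<le> 1" using lo hi by (auto simp: t_def D_def)
  show ?thesis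
  proof (rule that[of "\<lambda>x. lo x + t * (hi x - lo x)"])
    fix x
    show "lo x \<le> lo x + t * (hi x - lo x)" using t le[of x] by simp
    have "t * (hi x - lo x) \<le> 1 * (hi x - lo x)"
      using t le[of x] by (intro mult_right_mono) auto
    then show "lo x + t * (hi x - lo x) \<le> hi x" by simp
  next
    have "(\<Sum>x\<in>UNIV. lo x + t * (hi x - lo x)) = sum lo UNIV + t * D"
      by (simp add: D_def sum.distrib sum_distrib_left[symmetric] sum_subtractf)
    also have "\<dots> = 1" using \<open>D > 0\<close> by (simp add: t_def)
    finally show "(\<Sum>x\<in>UNIV. lo x + t * (hi x - lo x)) = 1" .
  qed
qed

text \<open>Collapsing the interval at \<open>x\<close> to the single point \<open>v\<close> gives a
  smaller box; the two sum hypotheses on \<open>v\<close> are exactly what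
  \<open>box_meets_simplex\<close> asks of it.\<close>

lemma box_simplex_coordinate:
  fixes lo hi :: "'x::finite \<Rightarrow> real"
  assumes le: "\<And>x. lo x \<le> hi x"
    and v: "lo x \<le> v" "v \<le> hi x"
      "1 - sum hi (UNIV - {x}) \<le> v" "v \<le> 1 - sum lo (UNIV - {x})"
  obtains c where "\<And>y. lo y \<le> c y" "\<And>y. c y \<le> hi y" "sum c UNIV = 1" "c x = v"
proof -
  have upd: "sum (f(x := v)) UNIV = v + sum f (UNIV - {x})" for f :: "'x \<Rightarrow> real"
    by (subst sum.remove[of _ x]) (auto intro!: sum.cong)
  have "(lo(x := v)) y \<le> (hi(x := v)) y" for y
    using le by simp
  moreover have "sum (lo(x := v)) UNIV \<le> 1" "1 \<le> sum (hi(x := v)) UNIV"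
    using v(3,4) by (simp_all only: upd)
  ultimately obtain c
    where c: "\<And>y. (lo(x := v)) y \<le> c y" "\<And>y. c y \<le> (hi(x := v)) y" "sum c UNIV = 1"
    using box_meets_simplex by blast
  have "c x = v" using c(1)[of x] c(2)[of x] by simp
  moreover have "lo y \<le> c y" "c y \<le> hi y" for y
    using c(1)[of y] c(2)[of y] v \<open>c x = v\<close> by (cases "y = x"; simp)+
  ultimately show ?thesis using that c(3) by blast
qed

section \<open>Consequences of the constraints (Prob) and (Int)\<close>

lemma sum_cf_prob:
  assumes "pmf (P sT aT) sN > 0" "int_constraint P \<theta>"
  shows "(\<Sum>x\<in>UNIV. cf_prob P sT aT sN \<theta> s a x) = 1"
proof -
  have "(\<Sum>x\<in>UNIV. \<Sum>u\<in>UNIV. scm_mu s a u x * scm_mu sT aT u sN * \<theta> u)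
      = (\<Sum>u\<in>UNIV. \<Sum>x\<in>UNIV. scm_mu s a u x * scm_mu sT aT u sN * \<theta> u)"
    by (rule sum.swap)
  also have "\<dots> = (\<Sum>u\<in>UNIV. scm_mu sT aT u sN * \<theta> u)"
    by (simp add: sum_distrib_right[symmetric] scm_mu_def)
  also have "\<dots> = pmf (P sT aT) sN"
    using assms by (simp add: int_constraint_def)
  finally show ?thesis
    using assms by (simp add: cf_prob_def sum_divide_distrib[symmetric])
qed

lemma cf_prob_nonneg:
  assumes "prob_constraint \<theta>"
  shows "0 \<le> cf_prob P sT aT sN \<theta> s a x"
  using assms unfolding cf_prob_def prob_constraint_def
  by (intro divide_nonneg_nonneg sum_nonneg) (auto simp: scm_mu_def)

lemma cf_prob_le_ratio:
  assumes "prob_constraint \<theta>" "int_constraint P \<theta>"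
  shows "cf_prob P sT aT sN \<theta> s a x \<le> pmf (P s a) x / pmf (P sT aT) sN"
proof -
  have "(\<Sum>u\<in>UNIV. scm_mu s a u x * scm_mu sT aT u sN * \<theta> u) \<le> (\<Sum>u\<in>UNIV. scm_mu s a u x * \<theta> u)"
    using assms(1) by (intro sum_mono) (auto simp: scm_mu_def prob_constraint_def)
  also have "\<dots> = pmf (P s a) x" using assms(2) by (simp add: int_constraint_def)
  finally show ?thesis unfolding cf_prob_def by (rule divide_right_mono) simp
qed

section \<open>Realising prescribed counterfactual distributions\<close>

lemma exists_scm_inducing:
  fixes P :: "'s::finite \<Rightarrow> 'a::finite \<Rightarrow> 's pmf" and c :: "'s \<times> 'a \<Rightarrow> 's \<Rightarrow> real"
  assumes pos: "pmf (P sT aT) sN > 0"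
    and nonneg: "\<And>k x. 0 \<le> c k x"
    and total: "\<And>k. sum (c k) UNIV = 1"
    and le: "\<And>s a x. pmf (P sT aT) sN * c (s, a) x \<le> pmf (P s a) x"
    and point: "\<And>x. c (sT, aT) x = (if x = sN then 1 else 0)"
  obtains \<theta> where "prob_constraint \<theta>" "int_constraint P \<theta>"
    "\<And>s a x. cf_prob P sT aT sN \<theta> s a x = c (s, a) x"
proof -
  define Z where "Z = pmf (P sT aT) sN"
  define p where "p k x = pmf (P (fst k) (snd k)) x" for k x
  \<comment> \<open>When \<open>Z = 1\<close> the second component has weight 0, so any probability
    vector serves; \<open>c k\<close> avoids the division by \<open>1 - Z\<close>.\<close>
  define d where "d k x = (if Z = 1 then c k x else (p k x - Z * c k x) / (1 - Z))" for k x
  have Z: "0 < Z" "Z \<le> 1" using pos by (auto simp: Z_def pmf_le_1)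
  have p_total: "sum (p k) UNIV = 1" for k
    by (simp add: p_def sum_pmf_eq_1)
  have le': "Z * c k x \<le> p k x" for k x
    using le[of "fst k" "snd k" x] by (simp add: Z_def p_def)
  have d_nonneg: "0 \<le> d k x" for k x
    using le'[of k x] Z nonneg[of k x] by (auto simp: d_def)
  have d_total: "sum (d k) UNIV = 1" for k
    using total[of k] p_total[of k]
    by (cases "Z = 1")
      (simp_all add: d_def sum_divide_distrib[symmetric] sum_subtractf sum_distrib_left[symmetric])
  have mixture: "Z * c k x + (1 - Z) * d k x = p k x" for k x
  proof (cases "Z = 1")
    case True
    \<comment> \<open>For \<open>Z = 1\<close>, \<open>c k\<close> lies below \<open>p k\<close>
      with the same total, so the two coincide.\<close>
    have "(\<Sum>y\<in>UNIV. p k y - c k y) = 0"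
      using total[of k] p_total[of k] by (simp add: sum_subtractf)
    moreover have "\<forall>y\<in>UNIV. 0 \<le> p k y - c k y" using le'[of k] True by simp
    ultimately have "p k x - c k x = 0"
      by (simp add: sum_nonneg_eq_0_iff)
    then show ?thesis using True by simp
  qed (simp add: d_def)
  define C where "C u = (\<Prod>j\<in>UNIV. c j (u j))" for u
  define D where "D u = (\<Prod>j\<in>UNIV. d j (u j))" for u
  define \<theta> where "\<theta> u = Z * C u + (1 - Z) * D u" for u
  have \<theta>_nonneg: "0 \<le> \<theta> u" for u
    unfolding \<theta>_def C_def D_def using Z
    by (intro add_nonneg_nonneg mult_nonneg_nonneg prod_nonneg ballI nonneg d_nonneg) simp_all
  have \<theta>_total: "sum \<theta> UNIV = 1"
    using sum_prod_total[of c] sum_prod_total[of d] total d_total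
    by (simp add: \<theta>_def sum.distrib sum_distrib_left[symmetric] C_def D_def)
  have \<theta>_le: "\<theta> u \<le> 1" for u
    using member_le_sum[of u UNIV \<theta>] \<theta>_nonneg \<theta>_total by simp
  have C_marginal: "(\<Sum>u\<in>UNIV. scm_mu s a u x * C u) = c (s, a) x" for s a x
    unfolding scm_mu_def C_def by (rule sum_prod_marginal) (rule total)
  have D_marginal: "(\<Sum>u\<in>UNIV. scm_mu s a u x * D u) = d (s, a) x" for s a x
    unfolding scm_mu_def D_def by (rule sum_prod_marginal) (rule d_total)
  have "int_constraint P \<theta>"
    unfolding int_constraint_def
  proof (intro allI)
    fix s a x
    have "(\<Sum>u\<in>UNIV. scm_mu s a u x * \<theta> u)
        = Z * (\<Sum>u\<in>UNIV. scm_mu s a u x * C u) + (1 - Z) * (\<Sum>u\<in>UNIV. scm_mu s a u x * D u)"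
      by (simp add: \<theta>_def distrib_left sum.distrib sum_distrib_left mult.left_commute)
    then show "(\<Sum>u\<in>UNIV. scm_mu s a u x * \<theta> u) = pmf (P s a) x"
      using mixture[of "(s, a)" x] by (simp add: C_marginal D_marginal p_def)
  qed
  moreover have "cf_prob P sT aT sN \<theta> s a x = c (s, a) x" for s a x
  proof -
    \<comment> \<open>\<open>C\<close> lives on the observed event \<open>u (sT, aT) = sN\<close>
      and the weighted \<open>D\<close> off it, so restricting \<open>\<theta>\<close> to that event
      leaves exactly \<open>Z * C\<close>.\<close>
    have C_obs: "scm_mu sT aT u sN * C u = C u" for u
    proof (cases "u (sT, aT) = sN")
      case False
      then have "c (sT, aT) (u (sT, aT)) = 0" by (simp add: point)
      then have "C u = 0" unfolding C_def by (intro prod_zero[OF finite]) blast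
      then show ?thesis by simp
    qed (simp add: scm_mu_def)
    have D_obs: "scm_mu sT aT u sN * ((1 - Z) * D u) = 0" for u
    proof (cases "u (sT, aT) = sN \<and> Z \<noteq> 1")
      case True
      \<comment> \<open>The point mass already uses up all of the mass \<open>Z\<close> that the
        observed pair gives to \<open>sN\<close>.\<close>
      then have "d (sT, aT) (u (sT, aT)) = 0" by (simp add: d_def point p_def Z_def)
      then have "D u = 0" unfolding D_def by (intro prod_zero[OF finite]) blast
      then show ?thesis by simp
    qed (auto simp: scm_mu_def)
    have "scm_mu sT aT u sN * \<theta> u = Z * C u" for u
      using C_obs[of u] D_obs[of u]
      by (simp only: \<theta>_def distrib_left mult.left_commute[of _ Z])
    then have "(\<Sum>u\<in>UNIV. scm_mu s a u x * scm_mu sT aT u sN * \<theta> u)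
        = Z * (\<Sum>u\<in>UNIV. scm_mu s a u x * C u)"
      by (simp add: mult.assoc sum_distrib_left mult.left_commute)
    then show ?thesis
      using Z by (simp add: cf_prob_def C_marginal flip: Z_def)
  qed
  ultimately show ?thesis
    using that[of \<theta>] \<theta>_nonneg \<theta>_le \<theta>_total by (auto simp: prob_constraint_def)
qed

section \<open>The box attached to a state-action pair\<close>

definition cf_lower :: "('s \<Rightarrow> 'a \<Rightarrow> 's pmf) \<Rightarrow> 's \<Rightarrow> 's \<Rightarrow> 'a \<Rightarrow> 's \<Rightarrow> real" where
  "cf_lower P sN s a x = (if x = sN then pmf (P s a) sN else 0)"

text \<open>The caps come, in order, from (Int) with total mass 1, from (CS), from (Mon2), and from
  (Int) alone: a joint probability is at most its marginal. Where (Mon2) applies it is at least as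
  strong as (Int).\<close>

definition cf_upper :: "('s \<Rightarrow> 'a \<Rightarrow> 's pmf) \<Rightarrow> 's \<Rightarrow> 'a \<Rightarrow> 's \<Rightarrow> 's \<Rightarrow> 'a \<Rightarrow> 's \<Rightarrow> real" where
  "cf_upper P sT aT sN s a x =
     (if x = sN then min 1 (pmf (P s a) sN / pmf (P sT aT) sN)
      else if cs_conditions P sT aT sN s a x then 0
      else if pmf (P sT aT) x > 0 then pmf (P s a) x
      else pmf (P s a) x / pmf (P sT aT) sN)"

context
  fixes P :: "'s::finite \<Rightarrow> 'a::finite \<Rightarrow> 's pmf" and sT sN :: 's and aT :: 'a
  assumes pos: "pmf (P sT aT) sN > 0"
begin

lemma pmf_le_ratio: "pmf (P s a) x \<le> pmf (P s a) x / pmf (P sT aT) sN"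
  using pos pmf_le_1[of "P sT aT" sN] by (simp add: le_divide_eq mult_left_le)

lemma cf_lower_le_upper: "cf_lower P sN s a x \<le> cf_upper P sT aT sN s a x"
  using pmf_le_ratio[of s a sN] by (auto simp: cf_lower_def cf_upper_def pmf_le_1)

lemma cf_upper_le_ratio: "cf_upper P sT aT sN s a x \<le> pmf (P s a) x / pmf (P sT aT) sN"
  using pmf_le_ratio[of s a x] by (auto simp: cf_upper_def)

text \<open>With \<open>r = P(sN | s, a) / P(sN | sT, aT)\<close> the cap at \<open>sN\<close> is
  \<open>min 1 r\<close>, so only \<open>r < 1\<close> needs work. There
  \<open>P(x | s, a) - r * P(x | sT, aT)\<close> vanishes at \<open>sN\<close> and totals
  \<open>1 - r\<close>. Off \<open>sN\<close> it stays below the cap: the CS conditions, which set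
  the cap to 0, also say that it is nonpositive.\<close>

lemma sum_cf_upper_ge_1: "1 \<le> sum (cf_upper P sT aT sN s a) UNIV"
proof -
  define Z where "Z = pmf (P sT aT) sN"
  define r where "r = pmf (P s a) sN / Z"
  have Z: "Z > 0" using pos by (simp add: Z_def)
  have r: "r \<ge> 0" "pmf (P s a) sN = r * Z" using Z by (auto simp: r_def)
  have upper_nonneg: "0 \<le> cf_upper P sT aT sN s a x" for x
    using Z by (auto simp: cf_upper_def)
  show ?thesis
  proof (cases "r \<ge> 1")
    case True
    then have "cf_upper P sT aT sN s a sN = 1" by (simp add: cf_upper_def r_def Z_def)
    then show ?thesis
      using member_le_sum[of sN UNIV "cf_upper P sT aT sN s a"] upper_nonneg by simp
  next
    case False
    have "pmf (P s a) x - r * pmf (P sT aT) x \<le> cf_upper P sT aT sN s a x" if "x \<noteq> sN" for x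
    proof (cases "cs_conditions P sT aT sN s a x")
      case True
      then have "pmf (P sT aT) x > 0" "pmf (P s a) x / pmf (P sT aT) x \<le> r"
        by (auto simp: cs_conditions_def r_def Z_def)
      then show ?thesis using that True by (simp add: cf_upper_def divide_le_eq)
    next
      case False
      then have "pmf (P s a) x \<le> cf_upper P sT aT sN s a x"
        using that pmf_le_ratio[of s a x] by (auto simp: cf_upper_def)
      moreover have "0 \<le> r * pmf (P sT aT) x" using r(1) by simp
      ultimately show ?thesis by linarith
    qed
    then have "(\<Sum>x\<in>UNIV - {sN}. pmf (P s a) x - r * pmf (P sT aT) x)
        \<le> (\<Sum>x\<in>UNIV - {sN}. cf_upper P sT aT sN s a x)"
      by (intro sum_mono) auto
    moreover have "cf_upper P sT aT sN s a sN = r"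
      using False by (simp add: cf_upper_def r_def Z_def)
    moreover have "(\<Sum>x\<in>UNIV. pmf (P s a) x - r * pmf (P sT aT) x) = 1 - r"
      by (simp add: sum_subtractf sum_distrib_left[symmetric] sum_pmf_eq_1)
    moreover have "pmf (P s a) sN - r * pmf (P sT aT) sN = 0" using r by (simp add: Z_def)
    ultimately show ?thesis
      by (simp add: sum.remove[of UNIV sN])
  qed
qed

lemma feasible_bounds:
  assumes "feasible P sT aT sN \<theta>" "(s, a) \<noteq> (sT, aT)"
  shows "cf_lower P sN s a x \<le> cf_prob P sT aT sN \<theta> s a x"
    and "cf_prob P sT aT sN \<theta> s a x \<le> cf_upper P sT aT sN s a x"
    and "(\<Sum>x\<in>UNIV. cf_prob P sT aT sN \<theta> s a x) = 1"
proof -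
  have prob: "prob_constraint \<theta>" and int: "int_constraint P \<theta>"
    and cs: "cs_constraint P sT aT sN \<theta>" and mon1: "mon1_constraint P sT aT sN \<theta>"
    and mon2: "mon2_constraint P sT aT sN \<theta>"
    using assms(1) by (auto simp: feasible_def)
  note nonneg = cf_prob_nonneg[OF prob, of P sT aT sN s a]
  show total: "(\<Sum>x\<in>UNIV. cf_prob P sT aT sN \<theta> s a x) = 1"
    by (rule sum_cf_prob[OF pos int])
  show "cf_lower P sN s a x \<le> cf_prob P sT aT sN \<theta> s a x"
    using mon1 nonneg[of x] nonneg[of sN] pmf_nonneg[of "P s a" sN]
    by (cases "pmf (P s a) sN > 0") (auto simp: cf_lower_def mon1_constraint_def)
  have "cf_prob P sT aT sN \<theta> s a x \<le> 1"
    using member_le_sum[of x UNIV "cf_prob P sT aT sN \<theta> s a"] nonneg total by simp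
  then show "cf_prob P sT aT sN \<theta> s a x \<le> cf_upper P sT aT sN s a x"
    using cf_prob_le_ratio[OF prob int, of sT aT sN s a x] cs mon2 assms(2)
    by (auto simp: cf_upper_def cs_constraint_def mon2_constraint_def)
qed

text \<open>Converse of \<open>feasible_bounds\<close>: the constraints never couple different
  unobserved pairs, so \<open>c\<close> can be completed by an arbitrary point of the box of every
  other pair.\<close>

lemma exists_feasible_inducing:
  assumes neq: "(s, a) \<noteq> (sT, aT)"
    and lo: "\<And>x. cf_lower P sN s a x \<le> c x" and hi: "\<And>x. c x \<le> cf_upper P sT aT sN s a x"
    and total: "sum c UNIV = 1"
  obtains \<theta> where "feasible P sT aT sN \<theta>" "\<And>x. cf_prob P sT aT sN \<theta> s a x = c x"
proof -
  have "\<exists>b. (\<forall>x. cf_lower P sN s' a' x \<le> b x \<and> b x \<le> cf_upper P sT aT sN s' a' x) \<and> sum b UNIV = 1"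
    for s' a'
  proof -
    have "sum (cf_lower P sN s' a') UNIV \<le> 1"
      by (simp add: cf_lower_def pmf_le_1)
    from box_meets_simplex[OF cf_lower_le_upper this sum_cf_upper_ge_1]
    show ?thesis by metis
  qed
  then obtain b where b: "\<And>s' a' x. cf_lower P sN s' a' x \<le> b s' a' x"
      "\<And>s' a' x. b s' a' x \<le> cf_upper P sT aT sN s' a' x" "\<And>s' a'. sum (b s' a') UNIV = 1"
    by metis
  define g where "g k = (if k = (sT, aT) then (\<lambda>x. if x = sN then 1 else 0)
      else if k = (s, a) then c else b (fst k) (snd k))" for k
  \<comment> \<open>The observed pair is included because (Mon1) ranges over it as well; the point
    mass has the value 1 at \<open>sN\<close> there.\<close>
  have g_lo: "cf_lower P sN s' a' x \<le> g (s', a') x" for s' a' x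
    using lo[of x] b(1)[of s' a' x] by (auto simp: g_def cf_lower_def pmf_le_1)
  have g_hi: "g (s', a') x \<le> cf_upper P sT aT sN s' a' x" if "(s', a') \<noteq> (sT, aT)" for s' a' x
    using that hi b by (auto simp: g_def)
  have g_ratio: "pmf (P sT aT) sN * g (s', a') x \<le> pmf (P s' a') x" for s' a' x
  proof (cases "(s', a') = (sT, aT)")
    case False
    then have "g (s', a') x \<le> pmf (P s' a') x / pmf (P sT aT) sN"
      using g_hi cf_upper_le_ratio order_trans by blast
    then show ?thesis using pos by (simp add: le_divide_eq mult.commute)
  qed (simp add: g_def)
  have g_nonneg: "0 \<le> g k x" for k x
    using g_lo[of "fst k" "snd k" x] by (auto simp: cf_lower_def split: if_splits intro: order_trans[OF pmf_nonneg])
  have g_total: "sum (g k) UNIV = 1" for k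
    using total b by (simp add: g_def)
  have g_point: "g (sT, aT) x = (if x = sN then 1 else 0)" for x
    by (simp add: g_def)
  obtain \<theta> where \<theta>: "prob_constraint \<theta>" "int_constraint P \<theta>"
    "\<And>s' a' x. cf_prob P sT aT sN \<theta> s' a' x = g (s', a') x"
    using exists_scm_inducing[of P sT aT sN g] pos g_nonneg g_total g_ratio g_point by blast
  have "cs_constraint P sT aT sN \<theta>"
    unfolding cs_constraint_def
  proof (intro allI impI)
    fix s' a' x
    assume "(s', a') \<noteq> (sT, aT)" "x \<noteq> sN" "cs_conditions P sT aT sN s' a' x"
    then show "cf_prob P sT aT sN \<theta> s' a' x = 0"
      using g_hi[of s' a' x] g_nonneg[of "(s', a')" x] by (simp add: \<theta>(3) cf_upper_def)
  qed
  moreover have "mon1_constraint P sT aT sN \<theta>"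
    using g_lo[of _ _ sN] by (simp add: mon1_constraint_def \<theta>(3) cf_lower_def)
  moreover have "mon2_constraint P sT aT sN \<theta>"
    unfolding mon2_constraint_def
  proof (intro allI impI)
    fix s' a' x
    assume "x \<noteq> sN" "pmf (P sT aT) x > 0"
    then show "cf_prob P sT aT sN \<theta> s' a' x \<le> pmf (P s' a') x"
      using g_hi[of s' a' x] g_point[of x]
      by (cases "(s', a') = (sT, aT)") (auto simp: \<theta>(3) cf_upper_def split: if_splits intro: order_trans)
  qed
  moreover have "g (s, a) x = c x" for x
    using neq by (auto simp: g_def)
  ultimately show ?thesis
    using that[of \<theta>] \<theta> by (simp add: feasible_def)
qed

section \<open>The attainable values form an interval\<close>

lemma cf_values_eq_interval:
  assumes "(s, a) \<noteq> (sT, aT)"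
  shows "cf_values P sT aT sN s a x =
    {max (cf_lower P sN s a x) (1 - sum (cf_upper P sT aT sN s a) (UNIV - {x})) ..
     min (cf_upper P sT aT sN s a x) (1 - sum (cf_lower P sN s a) (UNIV - {x}))}"
    (is "_ = ?I")
proof (intro equalityI subsetI)
  fix v
  assume "v \<in> cf_values P sT aT sN s a x"
  then obtain \<theta> where \<theta>: "feasible P sT aT sN \<theta>" and v: "v = cf_prob P sT aT sN \<theta> s a x"
    by (auto simp: cf_values_def)
  note bounds = feasible_bounds[OF \<theta> assms]
  \<comment> \<open>The other coordinates total \<open>1 - v\<close>, so their caps bound
    \<open>v\<close> from below and their floors bound it from above.\<close>
  have "v = 1 - sum (cf_prob P sT aT sN \<theta> s a) (UNIV - {x})"
    using bounds(3) by (simp add: v sum.remove[of UNIV x])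
  moreover have "sum (cf_lower P sN s a) (UNIV - {x}) \<le> sum (cf_prob P sT aT sN \<theta> s a) (UNIV - {x})"
    "sum (cf_prob P sT aT sN \<theta> s a) (UNIV - {x}) \<le> sum (cf_upper P sT aT sN s a) (UNIV - {x})"
    using bounds by (auto intro: sum_mono)
  ultimately show "v \<in> ?I" using bounds(1,2)[of x] by (auto simp flip: v)
next
  fix v
  assume "v \<in> ?I"
  then obtain c where c: "\<And>y. cf_lower P sN s a y \<le> c y" "\<And>y. c y \<le> cf_upper P sT aT sN s a y"
      "sum c UNIV = 1" "c x = v"
    using box_simplex_coordinate[where lo = "cf_lower P sN s a" and hi = "cf_upper P sT aT sN s a",
        OF cf_lower_le_upper, of x v] by auto
  obtain \<theta> where "feasible P sT aT sN \<theta>" "\<And>y. cf_prob P sT aT sN \<theta> s a y = c y"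
    using exists_feasible_inducing[OF assms c(1-3)] by blast
  then show "v \<in> cf_values P sT aT sN s a x"
    using c(4) by (auto simp: cf_values_def intro!: exI[of _ \<theta>])
qed

text \<open>Together with \<open>cf_values_eq_interval\<close> this yields the existence of a
  feasible \<open>\<theta>\<close>, and both endpoints are attained.\<close>

lemma cf_interval_nonempty:
  "max (cf_lower P sN s a x) (1 - sum (cf_upper P sT aT sN s a) (UNIV - {x}))
    \<le> min (cf_upper P sT aT sN s a x) (1 - sum (cf_lower P sN s a) (UNIV - {x}))"
proof -
  have "sum (cf_lower P sN s a) UNIV \<le> 1" by (simp add: cf_lower_def pmf_le_1)
  moreover have "sum (cf_lower P sN s a) (UNIV - {x}) \<le> sum (cf_upper P sT aT sN s a) (UNIV - {x})"
    by (intro sum_mono cf_lower_le_upper)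
  ultimately show ?thesis
    using sum_cf_upper_ge_1[of s a] cf_lower_le_upper[of s a x] by (simp add: sum.remove[of UNIV x])
qed

end

section \<open>Extrema and their closed forms\<close>

lemma is_maximum_atLeastAtMost: "l \<le> h \<Longrightarrow> is_maximum {l..h} m \<longleftrightarrow> m = h"
  by (auto simp: is_maximum_def intro: antisym)

lemma is_minimum_atLeastAtMost: "l \<le> h \<Longrightarrow> is_minimum {l..h} m \<longleftrightarrow> m = l"
  by (auto simp: is_minimum_def intro: antisym)

theorem theorem4p3:
  fixes P :: "'s::finite \<Rightarrow> 'a::finite \<Rightarrow> 's pmf"
    and sT sN s :: 's and aT a :: 'a
  assumes "pmf (P sT aT) sN > 0"
    and "(s, a) \<noteq> (sT, aT)"
    and "set_pmf (P s a) \<inter> set_pmf (P sT aT) \<noteq> {}"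
  shows "\<forall>s'.
    is_maximum (cf_values P sT aT sN s a s') (cf_UB P sT aT sN s a s') \<and>
    cf_UB P sT aT sN s a s' =
      (if s' = sN then min (pmf (P sT aT) sN) (pmf (P s a) sN) / pmf (P sT aT) sN
       else if cs_conditions P sT aT sN s a s' then 0
       else if pmf (P sT aT) s' > 0 then min (pmf (P s a) s') (1 - pmf (P s a) sN)
       else min (1 - pmf (P s a) sN) (pmf (P s a) s' / pmf (P sT aT) sN)) \<and>
    is_minimum (cf_values P sT aT sN s a s') (cf_LB P sT aT sN s a s') \<and>
    cf_LB P sT aT sN s a s' =
      (if s' = sN then
         max (pmf (P s a) s') (1 - (\<Sum>r\<in>UNIV - {s'}. cf_UB P sT aT sN s a r))
       else if cs_conditions P sT aT sN s a s' then 0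
       else max 0 (1 - (\<Sum>r\<in>UNIV - {s'}. cf_UB P sT aT sN s a r)))"
proof -
  let ?lo = "cf_lower P sN s a" and ?hi = "cf_upper P sT aT sN s a"
  let ?UB = "cf_UB P sT aT sN s a"
  note pos = assms(1)
  \<comment> \<open>A nonempty closed interval has its endpoints as unique extrema, so the definite
    descriptions evaluate to them.\<close>
  have UB: "is_maximum (cf_values P sT aT sN s a x) (?UB x)"
      "?UB x = min (?hi x) (1 - sum ?lo (UNIV - {x}))"
    and LB: "is_minimum (cf_values P sT aT sN s a x) (cf_LB P sT aT sN s a x)"
      "cf_LB P sT aT sN s a x = max (?lo x) (1 - sum ?hi (UNIV - {x}))" for x
    by (simp_all add: cf_UB_def cf_LB_def cf_values_eq_interval[of P sT aT sN s a, OF pos assms(2)]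
        is_maximum_atLeastAtMost is_minimum_atLeastAtMost cf_interval_nonempty[of P sT aT sN, OF pos]
        del: max.bounded_iff min.bounded_iff)
  have sum_lo: "sum ?lo (UNIV - {x}) = (if x = sN then 0 else pmf (P s a) sN)" for x
    by (auto simp: cf_lower_def)
  have hi_nonneg: "0 \<le> ?hi x" for x
    by (auto simp: cf_upper_def)
  have UB_sN: "?UB sN = ?hi sN" and hi_sN: "?hi sN = min (pmf (P sT aT) sN) (pmf (P s a) sN) / pmf (P sT aT) sN"
    using pos by (auto simp: UB(2) sum_lo cf_upper_def min_def field_simps)
  \<comment> \<open>The floor at \<open>sN\<close> reserves mass \<open>P(sN | s, a)\<close>, which
    limits every other state.\<close>
  have UB_other: "?UB x = min (?hi x) (1 - pmf (P s a) sN)" if "x \<noteq> sN" for x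
    using that by (simp add: UB(2) sum_lo)
  have UB_nonneg: "0 \<le> ?UB x" for x
    using hi_nonneg[of x] by (auto simp: UB(2) sum_lo pmf_le_1)
  \<comment> \<open>If the upper bound of some other state is cut off at \<open>1 - P(sN | s, a)\<close>, then both sums
    are so large that the maximum is attained at the lower end of the box.\<close>
  have LB_eq: "max (?lo x) (1 - sum ?hi (UNIV - {x})) = max (?lo x) (1 - sum ?UB (UNIV - {x}))" for x
  proof (cases "\<exists>y. y \<noteq> x \<and> ?UB y \<noteq> ?hi y")
    case True
    then obtain y where y: "y \<noteq> x" "?UB y \<noteq> ?hi y" by blast
    then have ysN: "y \<noteq> sN" using UB_sN by auto
    then have UBy: "?UB y = 1 - pmf (P s a) sN"
      using y(2) UB_other[of y] by linarith
    \<comment> \<open>For \<open>x = sN\<close> the state \<open>y\<close> alone contributes this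
      much; otherwise \<open>y\<close> and \<open>sN\<close> together contribute at least 1.\<close>
    have "1 - ?lo x \<le> sum ?UB (UNIV - {x})"
    proof (cases "x = sN")
      case True
      then show ?thesis
        using member_le_sum[of y "UNIV - {x}" ?UB] UB_nonneg y UBy by (simp add: cf_lower_def)
    next
      case False
      have "pmf (P s a) sN \<le> ?UB sN"
        using cf_lower_le_upper[of P sT aT sN s a sN, OF pos] by (simp add: UB_sN cf_lower_def)
      then have "1 \<le> sum ?UB {y, sN}" using ysN UBy by simp
      also have "\<dots> \<le> sum ?UB (UNIV - {x})"
        using False y UB_nonneg by (intro sum_mono2) auto
      finally show ?thesis using False by (simp add: cf_lower_def)
    qed
    moreover have "sum ?UB (UNIV - {x}) \<le> sum ?hi (UNIV - {x})"
      by (intro sum_mono) (simp add: UB(2))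
    ultimately show ?thesis by simp
  next
    case False
    then have "sum ?UB (UNIV - {x}) = sum ?hi (UNIV - {x})"
      by (intro sum.cong) auto
    then show ?thesis by simp
  qed
  \<comment> \<open>The cap and the floor at \<open>x\<close> are both 0, and nonemptiness of the
    interval prevents the other lower bound from exceeding the cap.\<close>
  have LB_cs: "cf_LB P sT aT sN s a x = 0" if "x \<noteq> sN" "cs_conditions P sT aT sN s a x" for x
    using cf_interval_nonempty[of P sT aT sN s a x, OF pos] that
    by (simp add: LB(2) cf_lower_def cf_upper_def)
  show ?thesis
  proof (intro allI conjI)
    fix x
    show "is_maximum (cf_values P sT aT sN s a x) (?UB x)"
      and "is_minimum (cf_values P sT aT sN s a x) (cf_LB P sT aT sN s a x)"
      by (fact UB(1) LB(1))+
    show "?UB x =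
      (if x = sN then min (pmf (P sT aT) sN) (pmf (P s a) sN) / pmf (P sT aT) sN
       else if cs_conditions P sT aT sN s a x then 0
       else if pmf (P sT aT) x > 0 then min (pmf (P s a) x) (1 - pmf (P s a) sN)
       else min (1 - pmf (P s a) sN) (pmf (P s a) x / pmf (P sT aT) sN))"
      using UB_sN hi_sN UB_other[of x] by (auto simp: cf_upper_def pmf_le_1 min.commute)
    show "cf_LB P sT aT sN s a x =
      (if x = sN then max (pmf (P s a) x) (1 - sum ?UB (UNIV - {x}))
       else if cs_conditions P sT aT sN s a x then 0
       else max 0 (1 - sum ?UB (UNIV - {x})))"
      using LB_cs[of x] LB(2)[of x] LB_eq[of x] by (auto simp: cf_lower_def)
  qed
qed

end
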